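(* Let $m$ be even and $\mathbb M=\mathbb F_{2^m}$. Every Carlet function on $\mathbb M\times\mathbb M$ is EA-equivalent to a Zhou-Pott function on $\mathbb M\times\mathbb M$.
   Context: For $q=2^k$ write $(a,b,c,d)_q=ax^{q+1}+bx^qy+cxy^q+dy^{q+1}$, $a,b,c,d\in\mathbb M$. Carlet functions: $(x,y)\mapsto(xy,(1,b,c,d)_q)$ with $q=2^k$, $0<k<m$, $\gcd(k,m)=1$, $b,c,d\in\mathbb M$ and $x^{q+1}+bx^q+cx+d\ne0$ for all $x\in\mathbb M$. Zhou-Pott functions ($m$ even): $(x,y)\mapsto((1,0,0,d)_q,(0,0,1,0)_r)=(x^{q+1}+dy^{q+1},xy^r)$ with $q=2^k$, $0<k<m$, $\gcd(k,m)=1$, $r=2^j$, $0\le j<m$, $d\in\mathbb M$ and $d\ne a^{q+1}(b^q+b)^{1-r}$ for all $a\in\mathbb M$ and all $b\in\mathbb M$ with $b^q+b\neq0$. With $V=\mathbb M\times\mathbb M$ and $\Gamma_F=\{(z,F(z)):z\in V\}$, functions $F,G:V\to V$ are EA-equivalent if there is an affine permutation $\mathcal A:(x,y)\mapsto\begin{pmatrix} M & 0 \\ N & L \end{pmatrix}\begin{pmatrix} x \\ y \end{pmatrix}+\begin{pmatrix} u \\ v \end{pmatrix}$ of $V\times V$ ($M,N,L$ being $\mathbb F_2$-linear maps of $V$, $u,v\in V$) with $\mathcal A(\Gamma_F)=\Gamma_G$. *)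

theory Defs
  imports Complex_Main "HOL-Library.Cardinality" "HOL-Library.Product_Plus" "HOL-Library.Z2"
begin

text \<open>
  The field \<open>M\<close> with \<open>2 ^ m\<close> elements is a type \<open>'a :: {field, finite}\<close> with
  \<open>CARD('a) = 2 ^ m\<close>, and \<open>V = M \<times> M\<close> is the type \<open>'a \<times> 'a\<close>.
\<close>

definition qform :: "nat \<Rightarrow> 'a::field \<Rightarrow> 'a \<Rightarrow> 'a \<Rightarrow> 'a \<Rightarrow> 'a \<Rightarrow> 'a \<Rightarrow> 'a" where
  "qform q a b c d x y = a * x ^ (q + 1) + b * x ^ q * y + c * x * y ^ q + d * y ^ (q + 1)"

definition carlet_function :: "nat \<Rightarrow> ('a::{field,finite} \<times> 'a \<Rightarrow> 'a \<times> 'a) \<Rightarrow> bool" where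
  "carlet_function m F \<longleftrightarrow>
     (\<exists>k q b c d. q = 2 ^ k \<and> 0 < k \<and> k < m \<and> gcd k m = 1 \<and>
        (\<forall>x. x ^ (q + 1) + b * x ^ q + c * x + d \<noteq> 0) \<and>
        F = (\<lambda>(x, y). (x * y, qform q 1 b c d x y)))"

text \<open>The exponent \<open>1 - r\<close> below is a nonpositive integer, hence the integer power.\<close>

definition zhou_pott_function :: "nat \<Rightarrow> ('a::{field,finite} \<times> 'a \<Rightarrow> 'a \<times> 'a) \<Rightarrow> bool" where
  "zhou_pott_function m F \<longleftrightarrow>
     even m \<and>
     (\<exists>k q j r d. q = 2 ^ k \<and> 0 < k \<and> k < m \<and> gcd k m = 1 \<and> r = 2 ^ j \<and> j < m \<and>
        (\<forall>a b. b ^ q + b \<noteq> 0 \<longrightarrow> d \<noteq> a ^ (q + 1) * (b ^ q + b) powi (1 - int r)) \<and>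
        F = (\<lambda>(x, y). (qform q 1 0 0 d x y, qform r 0 0 1 0 x y)))"

text \<open>
  The scalar multiplication of the two-element field on an abelian group. It makes the
  group a vector space exactly if the group has exponent dividing 2, as it does for
  \<open>M \<times> M\<close>.
\<close>

definition scaleF2 :: "bit \<Rightarrow> 'v::ab_group_add \<Rightarrow> 'v" where
  "scaleF2 c v = (if c = 0 then 0 else v)"

lemma vector_space_scaleF2:
  assumes "\<And>v :: 'v::ab_group_add. v + v = 0"
  shows "vector_space (scaleF2 :: bit \<Rightarrow> 'v \<Rightarrow> 'v)"
proof
  fix a b :: bit and x y :: 'v
  show "scaleF2 a (x + y) = scaleF2 a x + scaleF2 a y"
    by (simp add: scaleF2_def)
  show "scaleF2 (a + b) x = scaleF2 a x + scaleF2 b x"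
    by (cases a; cases b) (simp_all add: scaleF2_def assms)
  show "scaleF2 a (scaleF2 b x) = scaleF2 (a * b) x"
    by (cases a; cases b) (simp_all add: scaleF2_def)
  show "scaleF2 1 x = x"
    by (simp add: scaleF2_def)
qed

abbreviation F2_linear :: "('v::ab_group_add \<Rightarrow> 'w::ab_group_add) \<Rightarrow> bool" where
  "F2_linear \<equiv> Vector_Spaces.linear scaleF2 scaleF2"

definition fun_graph :: "('v \<Rightarrow> 'v) \<Rightarrow> ('v \<times> 'v) set" where
  "fun_graph F = {(z, F z) | z. True}"

definition EA_equivalent :: "('v::ab_group_add \<Rightarrow> 'v) \<Rightarrow> ('v \<Rightarrow> 'v) \<Rightarrow> bool" where
  "EA_equivalent F G \<longleftrightarrow>
     (\<exists>M N L u v A.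
        F2_linear M \<and> F2_linear N \<and> F2_linear L \<and>
        A = (\<lambda>(x, y). (M x + u, N x + L y + v)) \<and>
        bij A \<and> A ` fun_graph F = fun_graph G)"

end

theory Submission
  imports Defs "HOL-Computational_Algebra.Polynomial"
begin

text \<open>
  The target is a Zhou-Pott function with \<open>r = 1\<close>. A linear substitution over \<open>M\<close> changes
  \<open>x y\<close> only by a nonzero factor and by squares, which are additive, so it is enough to bring the
  anisotropic form \<open>(1, b, c, d)_q\<close> to diagonal shape: \<open>\<alpha> s^(q+1) + \<beta> t^(q+1)\<close> is
  anisotropic exactly if \<open>\<beta> / \<alpha>\<close> is not a \<open>(q+1)\<close>-th power, which is the Zhou-Pott condition.

  Unless the form is already diagonal after a shift, it reduces to
  \<open>X^(q+1) + X Y^q + a Y^(q+1)\<close> with \<open>a \<noteq> 0\<close>, and a diagonalising basis is a pair \<open>x \<noteq> y\<close> with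
  \<open>x (y^q + 1) = a = y (x^q + 1)\<close>. The existence of such a pair follows by counting. Let \<open>N = 2^m\<close>.
  The fibres of \<open>x \<mapsto> x^(q+1) + x\<close> over nonzero values have 0, 1 or 3 points, and at least \<open>N / 2\<close>
  nonzero \<open>a\<close> have exactly one preimage. At least \<open>(N - 2) / 2\<close> nonzero \<open>a\<close> admit a pair, since
  the pairs for all \<open>a\<close> are parametrised by the \<open>N - 2\<close> slopes \<open>x / (x + y)\<close> and each \<open>a\<close> has at
  most one unordered pair. No \<open>a\<close> is of both kinds, so the two kinds exhaust the \<open>N - 1\<close> nonzero
  elements, and an \<open>a\<close> without preimages admits a pair.
\<close>

section \<open>Roots of unity in finite fields, and powers of 2 modulo 3\<close>

text \<open>Multiplication by \<open>x\<close> permutes the nonzero elements, so their product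
  absorbs the factor \<open>x ^ (CARD('a) - 1)\<close>.\<close>

lemma finite_field_power_card_minus_1:
  fixes x :: "'a::{field,finite}"
  assumes "x \<noteq> 0"
  shows "x ^ (CARD('a) - 1) = 1"
proof -
  let ?U = "UNIV - {0 :: 'a}"
  have "(*) x ` ?U = ?U"
  proof (rule endo_inj_surj)
    show "inj_on ((*) x) ?U"
      using assms by (auto simp: inj_on_def)
  qed (use assms in auto)
  then have "prod id ?U = prod (id \<circ> (*) x) ?U"
    using assms by (metis (no_types, lifting) prod.reindex inj_on_def mult_left_cancel)
  also have "\<dots> = x ^ card ?U * prod id ?U"
    by (simp add: prod.distrib)
  finally show ?thesis
    by (simp add: card_Diff_singleton)
qed

text \<open>With \<open>CARD('a) - 1 = 3 * e\<close>, the polynomial \<open>X^e - 1\<close> has at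
  most \<open>e\<close> roots, so some nonzero \<open>x\<close> has \<open>x ^ e\<close> different
  from 1, and the cube of \<open>x ^ e\<close> is 1.\<close>

lemma exists_primitive_cube_root:
  fixes field_type :: "'a::{field,finite} itself"
  assumes "3 dvd CARD('a) - 1"
  obtains w :: 'a where "w ^ 3 = 1" "w \<noteq> 1"
proof -
  obtain e where e: "CARD('a) - 1 = 3 * e"
    using assms by blast
  have "card {0, 1 :: 'a} \<le> CARD('a)"
    by (rule card_mono) auto
  then have "e > 0"
    using e by auto
  have "\<exists>x::'a. x \<noteq> 0 \<and> x ^ e \<noteq> 1"
  proof (rule ccontr)
    assume *: "\<not> ?thesis"
    let ?p = "monom 1 e - 1 :: 'a poly"
    have deg: "degree ?p \<le> e"
      by (intro degree_diff_le) (auto simp: degree_monom_le)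
    have "poly ?p 0 \<noteq> 0"
      using \<open>e > 0\<close> by (simp add: poly_monom power_0_left)
    then have "?p \<noteq> 0"
      by auto
    then have "card {x. poly ?p x = 0} \<le> e"
      using card_poly_roots_bound deg le_trans by blast
    moreover have "card (UNIV - {0 :: 'a}) \<le> card {x. poly ?p x = 0}"
      by (rule card_mono) (use * in \<open>auto simp: poly_monom\<close>)
    ultimately have "CARD('a) - 1 \<le> e"
      by (simp add: card_Diff_singleton)
    then show False
      using e \<open>e > 0\<close> by simp
  qed
  then obtain x :: 'a where "x \<noteq> 0" "x ^ e \<noteq> 1"
    by blast
  moreover from \<open>x \<noteq> 0\<close> have "(x ^ e) ^ 3 = 1"
    using finite_field_power_card_minus_1[of x] e by (simp add: power_mult[symmetric] mult.commute)
  ultimately show thesis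
    using that by blast
qed

lemma four_power_mod_3: "(4::nat) ^ l mod 3 = 1"
proof (induction l)
  case (Suc l)
  have "4 ^ Suc l mod 3 = (4 * (4 ^ l mod 3)) mod (3::nat)"
    by (simp add: mod_mult_right_eq)
  then show ?case
    by (simp only: Suc) simp
qed simp

lemma three_dvd_two_power_minus_1:
  assumes "even n"
  shows "3 dvd (2::nat) ^ n - 1"
proof -
  obtain l where "n = 2 * l"
    using assms by blast
  then show ?thesis
    using dvd_minus_mod[of 3 "4 ^ l :: nat"] four_power_mod_3[of l] by (simp add: power_mult)
qed

lemma three_dvd_two_power_plus_1:
  assumes "odd n"
  shows "3 dvd (2::nat) ^ n + 1"
proof -
  obtain l where l: "n = 2 * l + 1"
    using assms oddE by blast
  have "x mod 3 = 1 \<Longrightarrow> 3 dvd x * 2 + 1" for x :: nat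
    by presburger
  from this[OF four_power_mod_3] have "3 dvd 4 ^ l * 2 + (1 :: nat)" .
  moreover have "2 ^ n = 4 ^ l * (2 :: nat)"
    by (simp add: l power_mult)
  ultimately show ?thesis
    by simp
qed

section \<open>The Frobenius power \<open>x^q\<close> in characteristic 2\<close>

locale coprime_frobenius =
  fixes field_type :: "'a::{field,finite} itself" and m k q :: nat
  assumes card_field: "CARD('a) = 2 ^ m"
    and even_m: "even m"
    and coprime_km: "coprime k m"
    and q_eq: "q = 2 ^ k"
begin

text \<open>The exponent \<open>2 ^ m - 1\<close> is odd, so raising -1 to it gives both -1 and
  1.\<close>

lemma two_eq_0 [simp]: "(2 :: 'a) = 0"
proof -
  have "card {0, 1 :: 'a} \<le> CARD('a)"
    by (rule card_mono) auto
  then have "m \<noteq> 0"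
    using card_field by (intro notI) simp
  then have "odd (2 ^ m - 1 :: nat)"
    by simp
  moreover have "(- 1 :: 'a) ^ (2 ^ m - 1) = 1"
    using finite_field_power_card_minus_1[of "- 1 :: 'a"] card_field by simp
  ultimately have "(- 1 :: 'a) = 1"
    by simp
  then show ?thesis
    by (metis add.right_inverse one_add_one)
qed

lemma add_self [simp]: "(x :: 'a) + x = 0"
  by (simp flip: mult_2)

lemma add_self_left [simp]: "(x :: 'a) + (x + y) = y"
  by (simp flip: add.assoc)

lemma uminus_id [simp]: "- (x :: 'a) = x"
  by (metis add_self neg_eq_iff_add_eq_0)

lemma diff_eq_add [simp]: "(x :: 'a) - y = x + y"
  by (metis uminus_id diff_conv_add_uminus)

lemma add_eq_0_iff_eq: "(x :: 'a) + y = 0 \<longleftrightarrow> x = y"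
  by (metis diff_eq_add eq_iff_diff_eq_0)

lemma odd_k: "odd k"
  using coprime_km even_m by (metis coprime_common_divisor odd_one)

lemma q_pos [simp]: "q > 0"
  by (simp add: q_eq)

lemma frob_add [simp]: "(x + y :: 'a) ^ q = x ^ q + y ^ q"
proof -
  have "(x + y) ^ (2 ^ n) = x ^ (2 ^ n) + y ^ (2 ^ n)" for n
  proof (induction n)
    case (Suc n)
    have "(x + y) ^ (2 ^ Suc n) = (x ^ (2 ^ n) + y ^ (2 ^ n)) ^ 2"
      by (simp add: Suc power_mult mult.commute[of 2])
    also have "\<dots> = x ^ (2 ^ Suc n) + y ^ (2 ^ Suc n)"
      by (simp add: power2_sum power_mult mult.commute[of 2])
    finally show ?case .
  qed simp
  then show ?thesis
    by (simp add: q_eq)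
qed

text \<open>A fixed point is also fixed by the power \<open>2 ^ m\<close>. Since \<open>k\<close>
  and \<open>m\<close> are coprime, Bezout gives \<open>k * i = m * j + 1\<close>, which makes it
  fixed by squaring.\<close>

lemma frob_fixed: "(x :: 'a) ^ q = x \<longleftrightarrow> x = 0 \<or> x = 1"
proof
  assume "x ^ q = x"
  then have 1: "x ^ (2 ^ (k * i)) = x" for i
    by (induction i) (simp_all add: power_add power_mult q_eq)
  have "x ^ (2 ^ m) = x"
  proof (cases "x = 0")
    case False
    have "x ^ CARD('a) = x * x ^ (CARD('a) - 1)"
      by (simp add: power_eq_if)
    then show ?thesis
      using finite_field_power_card_minus_1[OF False] card_field by simp
  qed simp
  then have 2: "y = x ^ 2 \<Longrightarrow> y ^ (2 ^ (m * i)) = y" for i y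
    by (induction i) (simp_all add: power_add power_mult, metis power_commutes power_mult mult.commute)
  have "k \<noteq> 0"
    using odd_k by (metis even_zero)
  then obtain i j where "k * i = m * j + 1"
    using bezout_nat[of k m] coprime_km by (auto simp: coprime_iff_gcd_eq_1)
  then have "x = (x ^ 2) ^ (2 ^ (m * j))"
    using 1[of i] by (simp flip: power_mult)
  then have "x ^ 2 = x"
    using 2 by simp
  then show "x = 0 \<or> x = 1"
    by (simp add: power2_eq_square)
qed auto

lemma frob_eq_iff [simp]: "(x :: 'a) ^ q = y ^ q \<longleftrightarrow> x = y"
  by (metis add_eq_0_iff_eq frob_add power_eq_0_iff q_pos)

lemma frob_0 [simp]: "(0 :: 'a) ^ q = 0"
  by (simp add: zero_power)

lemma frob_eq_1_iff [simp]: "(x :: 'a) ^ q = 1 \<longleftrightarrow> x = 1"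
  using frob_eq_iff[of x 1] by simp

lemma frob_surj: obtains x :: 'a where "x ^ q = c"
proof -
  have "inj (\<lambda>x :: 'a. x ^ q)"
    by (simp add: inj_def)
  then have "surj (\<lambda>x :: 'a. x ^ q)"
    by (simp add: finite_UNIV_inj_surj)
  then show thesis
    using that by (metis surjD)
qed

text \<open>If \<open>x^q / x = y^q / y\<close>, then \<open>x / y\<close> is a nonzero fixed point
  of Frobenius, hence 1. So the ratio map is injective on the finite set of nonzero elements, and
  therefore onto.\<close>

lemma ratio_frob_surj:
  assumes "(c :: 'a) \<noteq> 0"
  obtains t :: 'a where "t \<noteq> 0" "t ^ q = c * t"
proof -
  let ?U = "UNIV - {0 :: 'a}" and ?g = "\<lambda>t :: 'a. t ^ q / t"
  have "inj_on ?g ?U"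
  proof (rule inj_onI)
    fix x y :: 'a assume "x \<in> ?U" "y \<in> ?U" "x ^ q / x = y ^ q / y"
    then have "(x / y) ^ q = x / y" "x / y \<noteq> 0" "y \<noteq> 0"
      by (auto simp: power_divide field_simps)
    then show "x = y"
      using frob_fixed[of "x / y"] by simp
  qed
  then have "?g ` ?U = ?U"
    by (intro endo_inj_surj) auto
  then obtain t where "t \<in> ?U" "?g t = c"
    using assms by (metis (no_types, lifting) DiffI UNIV_I imageE singletonD)
  then show thesis
    using that[of t] by (auto simp: field_simps)
qed

text \<open>Even \<open>m\<close> puts a primitive cube root of unity \<open>w\<close> into the
  field. Odd \<open>k\<close> makes 3 divide \<open>q + 1\<close>, so \<open>w ^ q\<close> is the
  inverse of \<open>w\<close>, which is \<open>w + 1\<close>.\<close>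

lemma exists_omega:
  obtains w :: 'a where "w \<noteq> 0" "w \<noteq> 1" "w ^ q = w + 1" "w * w ^ q = 1"
proof -
  obtain w :: 'a where w: "w ^ 3 = 1" "w \<noteq> 1"
    using exists_primitive_cube_root three_dvd_two_power_minus_1[OF even_m] card_field by metis
  obtain e where "q + 1 = 3 * e"
    using three_dvd_two_power_plus_1[OF odd_k] unfolding q_eq by blast
  then have "w * w ^ q = (w ^ 3) ^ e"
    by (metis Suc_eq_plus1 power_Suc power_mult)
  then have 1: "w * w ^ q = 1"
    using w by simp
  have "(w + 1) * (w * w + w + 1) = w ^ 3 + 1"
    by (simp add: algebra_simps power3_eq_cube)
  then have "w * w + w + 1 = 0"
    using w by (auto simp: add_eq_0_iff_eq)
  then have "w * (w + 1) = 1"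
    by (simp add: algebra_simps add_eq_0_iff_eq)
  with 1 have "w ^ q = w + 1"
    by (metis mult_left_cancel mult_zero_left zero_neq_one)
  with 1 w(2) show thesis
    using that[of w] by fastforce
qed

subsection \<open>The fibres of \<open>x^(q+1) + x\<close>\<close>

text \<open>
  \<open>polar x y = a\<close> is orthogonality of \<open>(x, 1)\<close> and \<open>(y, 1)\<close> with respect to the sesquilinear
  form polarising \<open>X^(q+1) + X Y^q + a Y^(q+1)\<close>, and \<open>polar x x = a\<close> is isotropy of \<open>(x, 1)\<close>.
\<close>

definition polar :: "'a \<Rightarrow> 'a \<Rightarrow> 'a" where
  "polar x y = y * x ^ q + y"

lemma polar_self_eq_0_iff: "polar x x = 0 \<longleftrightarrow> x = 0 \<or> x = 1"
proof -
  have "polar x x = x * (x + 1) ^ q"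
    by (simp add: polar_def algebra_simps)
  then show ?thesis
    by (simp add: add_eq_0_iff_eq)
qed

text \<open>Adding the two values and clearing the denominator \<open>t^(q+1)\<close> leaves an
  equation in \<open>t\<close> that is affine over the two-element field.\<close>

lemma polar_shift_eq_iff:
  assumes "t \<noteq> 0"
  shows "polar (x + 1 / t) (x + 1 / t) = polar x x \<longleftrightarrow> (x ^ q + 1) * t ^ q + x * t = 1"
proof -
  have "polar (x + 1 / t) (x + 1 / t) + polar x x =
      ((x ^ q + 1) * t ^ q + x * t + 1) / (t * t ^ q)"
    using assms by (simp add: polar_def power_divide field_simps)
  then show ?thesis
    using assms by (metis add_eq_0_iff_eq divide_eq_0_iff mult_eq_0_iff power_not_zero)
qed

text \<open>
  By the preceding lemma, the other points of a fibre are \<open>x + 1 / t\<close> with \<open>t\<close> running through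
  the solutions of an affine equation whose linear part has a kernel of order 2.
\<close>

lemma polar_fibre_third_point:
  assumes "polar x x \<noteq> 0" "x \<noteq> y" "polar y y = polar x x"
  obtains y' where "y' \<noteq> x" "y' \<noteq> y" "polar y' y' = polar x x"
proof -
  have x: "x \<noteq> 0" "x ^ q + 1 \<noteq> 0"
    using assms(1) by (auto simp: polar_def add_eq_0_iff_eq)
  define t where "t = 1 / (x + y)"
  have t: "t \<noteq> 0" "y = x + 1 / t"
    using assms(2) by (auto simp: t_def add_eq_0_iff_eq)
  have E: "(x ^ q + 1) * t ^ q + x * t = 1"
    using polar_shift_eq_iff[OF t(1)] t(2) assms(3) by metis
  obtain u where u: "u \<noteq> 0" "u ^ q = x / (x ^ q + 1) * u"
    using ratio_frob_surj[of "x / (x ^ q + 1)"] x by auto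
  have K: "(x ^ q + 1) * u ^ q + x * u = 0"
    using x(2) unfolding u(2) by simp
  \<comment> \<open>\<open>t\<close> solves the inhomogeneous equation and \<open>u\<close> the
    homogeneous one, so they differ and \<open>1 / (t + u)\<close> is a genuine shift.\<close>
  have "t \<noteq> u"
    using E K by auto
  then have t': "t + u \<noteq> 0"
    by (simp add: add_eq_0_iff_eq)
  have "(x ^ q + 1) * (t + u) ^ q + x * (t + u) =
      ((x ^ q + 1) * t ^ q + x * t) + ((x ^ q + 1) * u ^ q + x * u)"
    by (simp add: algebra_simps)
  then have "polar (x + 1 / (t + u)) (x + 1 / (t + u)) = polar x x"
    using polar_shift_eq_iff[OF t'] E K by simp
  moreover have "x + 1 / (t + u) \<noteq> x"
    using t' by simp
  moreover have "x + 1 / (t + u) \<noteq> y"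
    using t t' u(1) by simp
  ultimately show thesis
    using that by blast
qed

definition singleton_fibre_values :: "'a set" where
  "singleton_fibre_values = {a. a \<noteq> 0 \<and> (\<exists>!x. polar x x = a)}"

text \<open>A pair is determined by its slope \<open>r = x / (x + y)\<close>, because
  \<open>1 / (x + y)^q = r^q + r + 1\<close>. The slope avoids 0 and 1, where \<open>x\<close> or
  \<open>y\<close> would be 0, and the roots \<open>w\<close> and \<open>w + 1\<close> of
  \<open>r^q + r + 1\<close>.\<close>

lemma card_polar_collisions:
  "card {(x, y). x \<noteq> y \<and> polar x x = polar y y \<and> polar x x \<noteq> 0} \<le> CARD('a) - 4"
  (is "card ?T \<le> _")
proof -
  obtain w :: 'a where w: "w \<noteq> 0" "w \<noteq> 1" "w ^ q = w + 1" "w * w ^ q = 1"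
    by (rule exists_omega)
  have "w \<noteq> w + 1"
    by simp
  then have "card {0, 1, w, w + 1} = 4"
    using w by (simp add: add_eq_0_iff_eq)
  then have card4: "card (- {0, 1, w, w + 1}) = CARD('a) - 4"
    by (simp add: Compl_eq_Diff_UNIV card_Diff_subset)
  let ?r = "\<lambda>(x, y). x / (x + y)"
  have slope: "1 / (x + y) ^ q = ?r (x, y) ^ q + ?r (x, y) + 1" if "(x, y) \<in> ?T" for x y
  proof -
    define t where "t = 1 / (x + y)"
    have t: "t \<noteq> 0" "y = x + 1 / t"
      using that by (auto simp: t_def add_eq_0_iff_eq)
    have "(x ^ q + 1) * t ^ q + x * t = 1"
      using polar_shift_eq_iff[OF t(1), of x] t(2) that by auto
    then have "x ^ q * t ^ q + t ^ q + x * t = 1"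
      by (simp add: algebra_simps)
    then have "t ^ q = (x * t) ^ q + x * t + 1"
      by (metis (no_types, lifting) add.assoc add.commute add_self_left power_mult_distrib)
    then show ?thesis
      by (simp add: t_def power_divide)
  qed
  have "inj_on ?r ?T"
  proof (rule inj_onI)
    fix p p' assume p: "p \<in> ?T" "p' \<in> ?T" "?r p = ?r p'"
    obtain x y x' y' where xy: "p = (x, y)" "p' = (x', y')"
      by fastforce
    have "1 / (x + y) ^ q = 1 / (x' + y') ^ q"
      using slope[OF p(1)[unfolded xy]] slope[OF p(2)[unfolded xy]] p(3)[unfolded xy] by (simp only:)
    then have z: "x + y = x' + y'"
      using frob_eq_iff[of "x + y" "x' + y'"] by (simp del: frob_add)
    moreover have "x + y \<noteq> 0"
      using p(1) xy by (simp add: add_eq_0_iff_eq)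
    ultimately have "x = x'"
      using p(3) xy by simp
    with z show "p = p'"
      using xy by simp
  qed
  moreover have "?r ` ?T \<subseteq> - {0, 1, w, w + 1}"
  proof
    fix v assume "v \<in> ?r ` ?T"
    then obtain x y where xy: "(x, y) \<in> ?T" "v = x / (x + y)"
      by auto
    have xy0: "x + y \<noteq> 0" "x \<noteq> 0" "y \<noteq> 0"
      using xy(1) polar_self_eq_0_iff[of x] polar_self_eq_0_iff[of y] by (auto simp: add_eq_0_iff_eq)
    then have "v \<noteq> 0" "v \<noteq> 1"
      using xy(2) by auto
    moreover have "v ^ q + v + 1 \<noteq> 0"
      using slope[OF xy(1)] xy0 xy(2) by (metis case_prod_conv divide_eq_0_iff power_not_zero zero_neq_one)
    then have "v \<noteq> w" "v \<noteq> w + 1"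
      using w(3) by (auto simp: add_ac)
    ultimately show "v \<in> - {0, 1, w, w + 1}"
      by simp
  qed
  ultimately have "card ?T \<le> card (- {0, 1, w, w + 1})"
    by (intro card_inj_on_le) auto
  then show ?thesis
    using card4 by simp
qed

text \<open>Each point of \<open>S\<close> has at least two partners in its fibre, so
  \<open>S\<close> has at most \<open>(N - 4) / 2\<close> points, where \<open>N\<close> is the size
  of the field. The other \<open>N - 2 - card S\<close> points outside 0 and 1 form
  \<open>R\<close>, and they have distinct values.\<close>

lemma card_singleton_fibre_values: "CARD('a) \<le> 2 * card singleton_fibre_values"
proof -
  let ?T = "{(x, y). x \<noteq> y \<and> polar x x = polar y y \<and> polar x x \<noteq> 0}"
  let ?Y = "\<lambda>x. {y. y \<noteq> x \<and> polar y y = polar x x}"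
  define S where "S = {x. polar x x \<noteq> 0 \<and> ?Y x \<noteq> {}}"
  define R where "R = {x. polar x x \<noteq> 0 \<and> ?Y x = {}}"
  have "card (S \<union> R) = CARD('a) - 2"
  proof -
    have "S \<union> R = - {0, 1}"
      using polar_self_eq_0_iff by (auto simp: S_def R_def)
    then show ?thesis
      by (simp add: Compl_eq_Diff_UNIV card_Diff_subset)
  qed
  moreover have "card (S \<union> R) = card S + card R"
    by (rule card_Un_disjoint) (auto simp: S_def R_def)
  moreover have "2 * card S \<le> card ?T"
  proof -
    have "2 \<le> card (?Y x)" if "x \<in> S" for x
    proof -
      obtain y where y: "y \<in> ?Y x"
        using \<open>x \<in> S\<close> by (auto simp: S_def)
      then obtain y' where "y' \<noteq> x" "y' \<noteq> y" "polar y' y' = polar x x"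
        using polar_fibre_third_point[of x y] \<open>x \<in> S\<close> by (auto simp: S_def)
      then have "{y, y'} \<subseteq> ?Y x" "card {y, y'} = 2"
        using y by auto
      then show ?thesis
        by (metis card_mono finite)
    qed
    then have "(\<Sum>x\<in>S. 2) \<le> (\<Sum>x\<in>S. card (?Y x))"
      by (rule sum_mono)
    also have "\<dots> = card (Sigma S ?Y)"
      by simp
    also have "\<dots> \<le> card ?T"
      by (rule card_mono) (auto simp: S_def)
    finally show ?thesis
      by (simp add: mult.commute)
  qed
  moreover have "card R \<le> card singleton_fibre_values"
  proof (rule card_inj_on_le)
    show "inj_on (\<lambda>x. polar x x) R"
      by (auto simp: inj_on_def R_def)
    show "(\<lambda>x. polar x x) ` R \<subseteq> singleton_fibre_values"
      unfolding R_def singleton_fibre_values_def by auto metis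
  qed simp
  \<comment> \<open>Ensures that the subtractions of natural numbers are not truncated.\<close>
  moreover have "4 \<le> CARD('a)"
  proof -
    obtain w :: 'a where w: "w \<noteq> 0" "w \<noteq> 1"
      using exists_omega by metis
    then have "card {0, 1, w, w + 1} = 4"
      by (simp add: add_eq_0_iff_eq)
    then show ?thesis
      by (metis card_mono finite subset_UNIV)
  qed
  ultimately show ?thesis
    using card_polar_collisions by linarith
qed

subsection \<open>Orthogonal pairs\<close>

text \<open>
  The left-hand side is the sesquilinear form polarising \<open>X^(q+1) + X Y^q + a Y^(q+1)\<close>, in the
  coordinates with respect to \<open>(x, 1)\<close> and \<open>(y, 1)\<close>. The mixed terms vanish when these two
  vectors are orthogonal.
\<close>

lemma form_in_coordinates:
  "(s' * x + t' * y) * (s * x + t * y) ^ q + (s' * x + t' * y) * (s + t) ^ q +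
      a * ((s' + t') * (s + t) ^ q) =
    s ^ q * s' * (polar x x + a) + s ^ q * t' * (polar x y + a) +
    t ^ q * s' * (polar y x + a) + t ^ q * t' * (polar y y + a)"
  by (simp add: polar_def algebra_simps power_mult_distrib)

text \<open>Coordinates with sum 1 keep the second component of \<open>s (x, 1) + t (y, 1)\<close>
  equal to 1, so the form on two such vectors is \<open>polar\<close> plus \<open>a\<close>.\<close>

lemma polar_in_coordinates:
  assumes "s + t = 1" "s' + t' = 1"
  shows "polar (s * x + t * y) (s' * x + t' * y) + a =
    s ^ q * s' * (polar x x + a) + s ^ q * t' * (polar x y + a) +
    t ^ q * s' * (polar y x + a) + t ^ q * t' * (polar y y + a)"
  using form_in_coordinates[of s' x t' y s t a] 
  by (simp only: assms polar_def[of "s * x + t * y"] power_one mult_1_right)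

lemma affine_coordinates:
  assumes "x \<noteq> (y :: 'a)"
  obtains s t where "s + t = 1" "X = s * x + t * y"
proof
  show "(X + y) / (x + y) + (X + x) / (x + y) = 1"
    using assms by (simp add: add_eq_0_iff_eq flip: add_divide_distrib) 
  have "(X + y) * x + (X + x) * y = X * (x + y)"
    by (simp add: algebra_simps)
  then have "X = ((X + y) * x + (X + x) * y) / (x + y)"
    using assms by (simp add: add_eq_0_iff_eq)
  then show "X = (X + y) / (x + y) * x + (X + x) / (x + y) * y"
    by (simp only: add_divide_distrib[of "(X + y) * x"] times_divide_eq_left)
qed

text \<open>Both orders are demanded because the sesquilinear form is not symmetric. The pairs are
  ordered, so each basis counts twice.\<close>

definition orthogonal_pairs :: "'a \<Rightarrow> ('a \<times> 'a) set" where
  "orthogonal_pairs a = {(x, y). x \<noteq> y \<and> polar x y = a \<and> polar y x = a}"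

text \<open>Makes the diagonal coefficients \<open>polar x x + a\<close> and
  \<open>polar y y + a\<close> nonzero: replacing one factor of \<open>y * (x ^ q + 1) = a\<close>
  by the different element \<open>x\<close> changes the value.\<close>

lemma orthogonal_pairs_nonzero:
  assumes "(x, y) \<in> orthogonal_pairs a"
  shows "a \<noteq> 0" "polar x x \<noteq> a" "polar y y \<noteq> a"
proof -
  have *: "x \<noteq> y" "y * (x ^ q + 1) = a" "x * (y ^ q + 1) = a"
    using assms by (auto simp: orthogonal_pairs_def polar_def algebra_simps)
  then show "a \<noteq> 0"
    by (auto simp: add_eq_0_iff_eq)
  then have "x ^ q + 1 \<noteq> 0" "y ^ q + 1 \<noteq> 0"
    using * by auto
  then have "x * (x ^ q + 1) \<noteq> y * (x ^ q + 1)" "y * (y ^ q + 1) \<noteq> x * (y ^ q + 1)"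
    using *(1) by auto
  then show "polar x x \<noteq> a" "polar y y \<noteq> a"
    using * by (auto simp: polar_def algebra_simps)
qed

text \<open>In the coordinates of the first pair, the two orthogonality relations of a second one
  multiply to say that \<open>(s * t') / (t * s')\<close> is fixed by Frobenius. If no coordinate
  vanishes, it is 1, which forces \<open>X = Y\<close>. So a coordinate vanishes, and the pair is
  the old one up to order.\<close>

lemma orthogonal_pairs_subset:
  assumes "(x, y) \<in> orthogonal_pairs a"
  shows "orthogonal_pairs a \<subseteq> {(x, y), (y, x)}"
proof
  fix p assume p: "p \<in> orthogonal_pairs a"
  obtain X Y where XY: "p = (X, Y)"
    by fastforce
  have xy: "x \<noteq> y" "polar x y + a = 0" "polar y x + a = 0"
    using assms by (auto simp: orthogonal_pairs_def)
  have P: "X \<noteq> Y" "polar X Y + a = 0" "polar Y X + a = 0"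
    using p XY by (auto simp: orthogonal_pairs_def)
  obtain s t where st: "s + t = 1" "X = s * x + t * y"
    using affine_coordinates[OF xy(1)] .
  obtain s' t' where st': "s' + t' = 1" "Y = s' * x + t' * y"
    using affine_coordinates[OF xy(1)] .
  define \<alpha> \<beta> where "\<alpha> = polar x x + a" and "\<beta> = polar y y + a"
  have nz: "\<alpha> \<noteq> 0" "\<beta> \<noteq> 0"
    using orthogonal_pairs_nonzero[OF assms] by (auto simp: \<alpha>_def \<beta>_def add_eq_0_iff_eq)
  have E: "s ^ q * s' * \<alpha> = t ^ q * t' * \<beta>" "s' ^ q * s * \<alpha> = t' ^ q * t * \<beta>"
    using polar_in_coordinates[OF st(1) st'(1), of x y a] polar_in_coordinates[OF st'(1) st(1), of x y a] xy P
    by (simp_all add: st(2) st'(2) add_eq_0_iff_eq \<alpha>_def \<beta>_def)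
  have t: "t = 1 + s" "t' = 1 + s'"
    using st(1) st'(1) by (metis add.commute add_self_left)+
  have ne: "s \<noteq> s'"
    using P(1) st(2) st'(2) t by auto
  show "p \<in> {(x, y), (y, x)}"
  proof (cases "s * t * s' * t' = 0")
    case True
    then have "s = 0 \<and> s' = 1 \<or> s = 1 \<and> s' = 0"
      using E nz ne t by (auto simp: add_eq_0_iff_eq)
    then show ?thesis
      using XY st st' t by auto
  next
    case False
    then have "(s ^ q * s' * \<alpha>) * (t' ^ q * t * \<beta>) = (t ^ q * t' * \<beta>) * (s' ^ q * s * \<alpha>)"
      using E by simp
    then have "((s * t') / (t * s')) ^ q = (s * t') / (t * s')"
      using False nz by (simp add: power_divide power_mult_distrib field_simps)
    then have "s * t' = t * s'"
      using frob_fixed[of "(s * t') / (t * s')"] False by auto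
    then show ?thesis
      using ne t by (simp add: algebra_simps)
  qed
qed

text \<open>For a pair with slope \<open>w = x / (x + y)\<close>, equality of
  \<open>polar x y\<close> and \<open>polar y x\<close> forces the sum \<open>z = x + y\<close> to
  satisfy \<open>(w^q + w) * z^q = 1\<close>. Conversely, every \<open>w\<close> other than 0 and 1
  yields a pair in this way.\<close>

lemma card_orthogonal_values:
  "CARD('a) - 2 \<le> 2 * card {a. orthogonal_pairs a \<noteq> {}}" (is "_ \<le> 2 * card ?A")
proof -
  have "\<exists>z :: 'a. z ^ q = 1 / (w ^ q + w)" for w
    using frob_surj by metis
  then obtain \<zeta> :: "'a \<Rightarrow> 'a" where \<zeta>: "\<And>w. \<zeta> w ^ q = 1 / (w ^ q + w)"
    by metis
  let ?p = "\<lambda>w. (w * (w + 1) * \<zeta> w * \<zeta> w ^ q, w * \<zeta> w, (w + 1) * \<zeta> w)"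
  have nz: "\<zeta> w \<noteq> 0" "(w ^ q + w) * \<zeta> w ^ q = 1" if "w \<in> - {0, 1}" for w
  proof -
    have "w ^ q + w \<noteq> 0"
      using that frob_fixed[of w] by (auto simp: add_eq_0_iff_eq)
    then show "(w ^ q + w) * \<zeta> w ^ q = 1"
      using \<zeta>[of w] by simp
    then show "\<zeta> w \<noteq> 0"
      by auto
  qed
  have "card (- {0, 1 :: 'a}) \<le> card (Sigma ?A orthogonal_pairs)"
  proof (rule card_inj_on_le)
    show "inj_on ?p (- {0, 1})"
    proof (rule inj_onI)
      fix v w assume vw: "v \<in> - {0, 1}" "w \<in> - {0, 1}" "?p v = ?p w"
      then have "v * \<zeta> v = w * \<zeta> w" "(v + 1) * \<zeta> v = (w + 1) * \<zeta> w"
        by simp_all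
      moreover from this have "\<zeta> v = \<zeta> w"
        unfolding distrib_right by simp
      ultimately show "v = w"
        using nz[OF vw(2)] by simp
    qed
    show "?p ` (- {0, 1}) \<subseteq> Sigma ?A orthogonal_pairs"
    proof
      fix p assume "p \<in> ?p ` (- {0, 1})"
      then obtain w where w: "w \<in> - {0, 1}" "p = ?p w"
        by blast
      have E: "w ^ q * \<zeta> w ^ q + w * \<zeta> w ^ q = 1"
        using nz(2)[OF w(1)] by (simp add: distrib_right)
      then have 1: "w ^ q * \<zeta> w ^ q = w * \<zeta> w ^ q + 1"
        by (metis add.commute add_self_left)
      have "polar (w * \<zeta> w) ((w + 1) * \<zeta> w) = w * (w + 1) * \<zeta> w * \<zeta> w ^ q"
        unfolding polar_def power_mult_distrib 1 by (simp add: algebra_simps)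
      moreover have "polar ((w + 1) * \<zeta> w) (w * \<zeta> w) = w * (w + 1) * \<zeta> w * \<zeta> w ^ q"
        unfolding polar_def power_mult_distrib frob_add distrib_right 1 by (simp add: algebra_simps)
      ultimately have "(w * \<zeta> w, (w + 1) * \<zeta> w) \<in> orthogonal_pairs (w * (w + 1) * \<zeta> w * \<zeta> w ^ q)"
        using nz(1)[OF w(1)] by (simp add: orthogonal_pairs_def)
      then show "p \<in> Sigma ?A orthogonal_pairs"
        unfolding w(2) by blast
    qed
  qed simp
  also have "card (Sigma ?A orthogonal_pairs) = (\<Sum>a\<in>?A. card (orthogonal_pairs a))"
    by simp
  also have "\<dots> \<le> (\<Sum>a\<in>?A. 2)"
  proof (rule sum_mono)
    fix a assume "a \<in> ?A"
    then obtain x y where "(x, y) \<in> orthogonal_pairs a"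
      by auto
    then have "card (orthogonal_pairs a) \<le> card {(x, y), (y, x)}"
      by (intro card_mono orthogonal_pairs_subset) auto
    also have "\<dots> \<le> 2"
      using card_insert_le_m1[of 2 "{(y, x)}" "(x, y)"] by simp
    finally show "card (orthogonal_pairs a) \<le> 2" .
  qed
  finally show ?thesis
    by (simp add: Compl_eq_Diff_UNIV card_Diff_subset mult.commute)
qed

text \<open>
  In orthogonal coordinates the fibre is \<open>\<alpha> s^(q+1) + \<beta> t^(q+1) = 0\<close>, on which multiplication
  of \<open>s\<close> by a primitive cube root of unity acts without fixed points.
\<close>

lemma orthogonal_value_not_singleton_fibre:
  assumes "(x, y) \<in> orthogonal_pairs a"
  shows "a \<notin> singleton_fibre_values"
proof
  assume "a \<in> singleton_fibre_values"
  then obtain X where X: "polar X X = a" "\<And>Y. polar Y Y = a \<Longrightarrow> Y = X"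
    by (auto simp: singleton_fibre_values_def)
  have xy: "x \<noteq> y" "polar x y + a = 0" "polar y x + a = 0"
    using assms by (auto simp: orthogonal_pairs_def)
  define \<alpha> \<beta> where "\<alpha> = polar x x + a" and "\<beta> = polar y y + a"
  have nz: "\<alpha> \<noteq> 0" "\<beta> \<noteq> 0"
    using orthogonal_pairs_nonzero[OF assms] by (auto simp: \<alpha>_def \<beta>_def add_eq_0_iff_eq)
  have diag: "polar (s * x + t * y) (s * x + t * y) + a = \<alpha> * (s ^ q * s) + \<beta> * (t ^ q * t)"
    if "s + t = 1" for s t
    using polar_in_coordinates[OF that that, of x y a] unfolding xy(2,3) by (simp add: \<alpha>_def \<beta>_def mult_ac)
  obtain s t where st: "s + t = 1" "X = s * x + t * y"
    using affine_coordinates[OF xy(1)] .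
  have E: "\<alpha> * (s ^ q * s) = \<beta> * (t ^ q * t)"
    using diag[OF st(1)] X(1) st(2) by (simp add: add_eq_0_iff_eq)
  have nz': "s \<noteq> 0" "t \<noteq> 0"
    using E nz st(1) by auto
  obtain w :: 'a where w: "w \<noteq> 0" "w \<noteq> 1" "w ^ q = w + 1" "w * w ^ q = 1"
    by (rule exists_omega)
  \<comment> \<open>Orthogonality cancels the mixed terms, leaving
    \<open>\<alpha> + \<beta> = (x + y)^(q+1)\<close>.\<close>
  have "\<alpha> \<noteq> \<beta>"
  proof
    assume eq: "\<alpha> = \<beta>"
    have "(x * y ^ q + x) + (y * x ^ q + y) = 0"
      using assms by (simp add: orthogonal_pairs_def polar_def)
    moreover have "(x + y) * (x + y) ^ q = (\<alpha> + \<beta>) + ((x * y ^ q + x) + (y * x ^ q + y))"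
      by (simp add: \<alpha>_def \<beta>_def polar_def algebra_simps)
    ultimately have "(x + y) * (x + y) ^ q = 0"
      by (simp only: eq add_self)
    then show False
      using xy(1) by (simp add: add_eq_0_iff_eq del: frob_add)
  qed
  have "w * s + t \<noteq> 0"
  proof
    assume "w * s + t = 0"
    then have "t = w * s"
      by (simp add: add_eq_0_iff_eq)
    then have "\<alpha> * (s ^ q * s) = \<beta> * ((w * w ^ q) * (s ^ q * s))"
      using E by (simp add: power_mult_distrib mult_ac)
    then show False
      using w(4) nz' \<open>\<alpha> \<noteq> \<beta>\<close> by simp
  qed
  \<comment> \<open>Replacing \<open>s\<close> by \<open>w * s\<close> preserves the diagonal
    equation, since \<open>w^(q+1) = 1\<close>. Dividing by \<open>w * s + t\<close> restores
    coordinates with sum 1.\<close>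
  define s' t' where "s' = w * s / (w * s + t)" and "t' = t / (w * s + t)"
  have s't': "s' + t' = 1"
    using \<open>w * s + t \<noteq> 0\<close> by (simp add: s'_def t'_def flip: add_divide_distrib)
  have "\<alpha> * (s' ^ q * s') = (w * w ^ q) * (\<alpha> * (s ^ q * s)) / ((w * s + t) ^ q * (w * s + t))"
    by (simp add: s'_def power_divide power_mult_distrib mult_ac del: frob_add)
  also have "\<dots> = \<beta> * (t' ^ q * t')"
    unfolding E w(4) by (simp add: t'_def power_divide power_mult_distrib mult_ac del: frob_add)
  finally have "polar (s' * x + t' * y) (s' * x + t' * y) = a"
    using diag[OF s't'] by (simp add: add_eq_0_iff_eq)
  then have "s' * x + t' * y = s * x + t * y"
    using X(2) st(2) by blast
  moreover have "t = 1 + s" "t' = 1 + s'"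
    using st(1) s't' by (metis add.commute add_self_left)+
  ultimately have "s * (x + y) = s' * (x + y)"
    by (simp add: algebra_simps)
  then have "s = s'" "t = t'"
    using xy(1) \<open>t = 1 + s\<close> \<open>t' = 1 + s'\<close> by (auto simp: add_eq_0_iff_eq)
  then have "s = w * s"
    using nz' \<open>w * s + t \<noteq> 0\<close> unfolding s'_def t'_def by (metis divide_eq_eq mult_cancel_left1 mult_1)
  then show False
    using w(2) nz' by simp
qed

lemma orthogonal_pair_exists:
  assumes "a \<noteq> 0" "\<And>x. polar x x \<noteq> a"
  obtains x y where "(x, y) \<in> orthogonal_pairs a"
proof -
  let ?A = "{a. orthogonal_pairs a \<noteq> {}}"
  have disj: "?A \<inter> singleton_fibre_values = {}"
    using orthogonal_value_not_singleton_fibre by fast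
  have sub: "?A \<union> singleton_fibre_values \<subseteq> UNIV - {0}"
    using orthogonal_pairs_nonzero(1) by (fastforce simp: singleton_fibre_values_def)
  have "CARD('a) - 1 \<le> card ?A + card singleton_fibre_values"
    using card_orthogonal_values card_singleton_fibre_values by linarith
  then have "card (UNIV - {0 :: 'a}) \<le> card (?A \<union> singleton_fibre_values)"
    using disj by (simp add: card_Un_disjoint card_Diff_singleton)
  then have "?A \<union> singleton_fibre_values = UNIV - {0}"
    using sub by (intro card_seteq) auto
  moreover have "a \<notin> singleton_fibre_values"
    using assms(2) by (auto simp: singleton_fibre_values_def)
  ultimately have "orthogonal_pairs a \<noteq> {}"
    using assms(1) by auto
  then show thesis
    using that by auto
qed

subsection \<open>Diagonalisation and EA-equivalence\<close>

text \<open>Homogeneity of degree \<open>q + 1\<close> reduces the case of nonzero \<open>y\<close>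
  to \<open>y = 1\<close>.\<close>

lemma anisotropic:
  assumes "\<And>x :: 'a. x ^ (q + 1) + b * x ^ q + c * x + d \<noteq> 0"
    and "qform q 1 b c d x y = 0"
  shows "x = 0 \<and> y = 0"
proof (cases "y = 0")
  case True
  then show ?thesis
    using assms(2) by (simp add: qform_def)
next
  case False
  define u where "u = x / y"
  have "x = u * y"
    using False by (simp add: u_def)
  then have "qform q 1 b c d x y = (u ^ (q + 1) + b * u ^ q + c * u + d) * y ^ (q + 1)"
    by (simp add: qform_def algebra_simps power_mult_distrib)
  then show ?thesis
    using assms False by simp
qed

text \<open>Shifting \<open>x\<close> by \<open>b * y\<close> removes the term in
  \<open>x^q y\<close> and leaves the mixed coefficient \<open>c + b^q\<close>. If this is 0, the
  form is diagonal. Otherwise, scaling by its \<open>q\<close>-th root \<open>e\<close> gives the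
  normal form, and anisotropy supplies the hypotheses for an orthogonal pair.\<close>

lemma qform_diagonal_coordinates:
  assumes P: "\<And>x :: 'a. x ^ (q + 1) + b * x ^ q + c * x + d \<noteq> 0"
  obtains p1 p2 p3 p4 \<alpha> \<beta> where "p1 * p4 + p2 * p3 \<noteq> 0"
    "\<And>x y. qform q 1 b c d x y = \<alpha> * (p1 * x + p2 * y) ^ (q + 1) + \<beta> * (p3 * x + p4 * y) ^ (q + 1)"
proof (cases "c = b ^ q")
  case True
  have "qform q 1 b c d x y = 1 * (1 * x + b * y) ^ (q + 1) + (d + b * c) * (0 * x + 1 * y) ^ (q + 1)" for x y
    by (simp add: qform_def True algebra_simps power_mult_distrib)
  then show thesis
    by (intro that[of 1 1 b 0 1 "d + b * c"]) simp_all
next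
  case False
  obtain e :: 'a where e: "e ^ q = c + b ^ q"
    by (rule frob_surj)
  have e0: "e \<noteq> 0" "e * e ^ q \<noteq> 0"
    using e False by (auto simp: add_eq_0_iff_eq)
  define a where "a = (d + b * c) / (e * e ^ q)"
  have a: "e * e ^ q * a = d + b * c"
    using e0 by (simp add: a_def)
  have shift: "qform q 1 b c d (e * X + b * Y) Y = e * e ^ q * (X * X ^ q + X * Y ^ q + a * (Y * Y ^ q))" for X Y
  proof -
    have "qform q 1 b c d (e * X + b * Y) Y =
        e * e ^ q * (X * X ^ q) + e * (c + b ^ q) * (X * Y ^ q) + (d + b * c) * (Y * Y ^ q)"
      by (simp add: qform_def algebra_simps power_mult_distrib)
    then show ?thesis
      unfolding e[symmetric] a[symmetric] by (simp only: distrib_left mult.assoc)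
  qed
  have shift1: "(e * X + b) ^ (q + 1) + b * (e * X + b) ^ q + c * (e * X + b) + d = e * e ^ q * (polar X X + a)" for X
    using shift[of X 1] by (simp add: qform_def polar_def)
  have "a \<noteq> 0"
    using shift1[of 0] P[of b] by (auto simp: polar_def)
  moreover have "polar X X \<noteq> a" for X
    using shift1[of X] P[of "e * X + b"] by (metis add_self mult_zero_right)
  ultimately obtain x0 y0 where xy: "(x0, y0) \<in> orthogonal_pairs a"
    using orthogonal_pair_exists by blast
  then have z: "x0 + y0 \<noteq> 0" "polar x0 y0 + a = 0" "polar y0 x0 + a = 0"
    by (auto simp: orthogonal_pairs_def add_eq_0_iff_eq)
  define z where "z = x0 + y0"
  \<comment> \<open>These solve \<open>s * x0 + t * y0 = (x + b * y) / e\<close> and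
    \<open>s + t = y\<close> for \<open>s\<close> and \<open>t\<close>. Both have the same
    coefficient of \<open>x\<close>, so \<open>p1\<close> occurs twice.\<close>
  define p1 p2 p4 where "p1 = 1 / (e * z)" and "p2 = (b / e + y0) / z" and "p4 = (b / e + x0) / z"
  show thesis
  proof (rule that)
    have "p2 + p4 = 1"
      using z(1) by (simp add: p2_def p4_def z_def algebra_simps flip: add_divide_distrib)
    then have "p1 * p4 + p2 * p1 = p1"
      by (metis add.commute distrib_left mult.commute mult.right_neutral)
    then show "p1 * p4 + p2 * p1 \<noteq> 0"
      using e0 z(1) by (simp add: p1_def z_def)
    fix x y
    define s t where "s = p1 * x + p2 * y" and "t = p1 * x + p4 * y"
    define X where "X = s * x0 + t * y0"
    have "s + t = (p2 + p4) * y"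
      by (simp add: s_def t_def algebra_simps)
    then have y: "s + t = y"
      using \<open>p2 + p4 = 1\<close> by simp
    have "e * X + b * y = x"
    proof -
      define g where "g = x / e + (b / e) * y"
      have s: "z * s = g + y0 * y" and t: "z * t = g + x0 * y"
        using z(1) by (simp_all add: g_def s_def t_def p1_def p2_def p4_def z_def[symmetric] distrib_left distrib_right add_divide_distrib)
      have "z * X = (z * s) * x0 + (z * t) * y0"
        by (simp add: X_def algebra_simps)
      also have "\<dots> = z * g"
        unfolding s t by (simp add: z_def algebra_simps)
      finally have "X = x / e + (b / e) * y"
        using z(1) by (simp add: z_def g_def)
      then show ?thesis
        using e0 by (simp add: distrib_left)
    qed
    then have "qform q 1 b c d x y = e * e ^ q * (X * X ^ q + X * y ^ q + a * (y * y ^ q))"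
      using shift[of X y] by simp
    also have "\<dots> = e * e ^ q * (s ^ q * s * (polar x0 x0 + a) + t ^ q * t * (polar y0 y0 + a))"
      using form_in_coordinates[of s x0 t y0 s t a] unfolding z(2,3) y X_def[symmetric]
      by simp
    also have "\<dots> = (e * e ^ q * (polar x0 x0 + a)) * s ^ (q + 1) + (e * e ^ q * (polar y0 y0 + a)) * t ^ (q + 1)"
      by (simp add: algebra_simps)
    finally show "qform q 1 b c d x y = (e * e ^ q * (polar x0 x0 + a)) * (p1 * x + p2 * y) ^ (q + 1) +
        (e * e ^ q * (polar y0 y0 + a)) * (p1 * x + p4 * y) ^ (q + 1)"
      unfolding s_def t_def .
  qed
qed

text \<open>The only scalars are 0 and 1, so additivity suffices.\<close>

lemma F2_linearI:
  fixes f :: "'a \<times> 'a \<Rightarrow> 'a \<times> 'a"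
  assumes "\<And>v w. f (v + w) = f v + f w"
  shows "F2_linear f"
proof -
  have "vector_space (scaleF2 :: bit \<Rightarrow> 'a \<times> 'a \<Rightarrow> 'a \<times> 'a)"
    by (rule vector_space_scaleF2) (simp add: prod_eq_iff)
  moreover have "f 0 = 0"
    using assms[of 0 0] by simp
  ultimately show ?thesis
    unfolding Vector_Spaces.linear_iff by (simp add: scaleF2_def assms)
qed

end

lemma fun_graph_eq_range: "fun_graph F = range (\<lambda>z. (z, F z))"
  by (auto simp: fun_graph_def)

text \<open>The block triangular map without translation sends \<open>(z, F z)\<close> to
  \<open>(M z, G (M z))\<close>. It is bijective because its diagonal blocks are.\<close>

lemma EA_equivalentI:
  assumes "F2_linear M" "F2_linear N" "F2_linear L" "bij M" "bij L"
    and "\<And>z. G (M z) = N z + L (F z)"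
  shows "EA_equivalent F G"
proof -
  let ?A = "\<lambda>(x, y). (M x + 0, N x + L y + 0)"
  have "inj ?A"
    using bij_is_inj[OF assms(4)] bij_is_inj[OF assms(5)] by (auto simp: inj_eq intro!: injI)
  moreover have "surj ?A"
  proof (rule surjI)
    show "?A (case p of (u, v) \<Rightarrow> (inv M u, inv L (v - N (inv M u)))) = p" for p
      using bij_is_surj[OF assms(4)] bij_is_surj[OF assms(5)] by (simp add: surj_f_inv_f split: prod.split)
  qed
  moreover have "?A ` fun_graph F = fun_graph G"
  proof -
    have "?A ` fun_graph F = (\<lambda>z. (M z, G (M z))) ` UNIV"
      by (simp add: fun_graph_eq_range assms(6) image_image)
    also have "\<dots> = (\<lambda>z. (z, G z)) ` range M"
      by (simp add: image_image)
    also have "\<dots> = fun_graph G"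
      using bij_is_surj[OF assms(4)] by (simp add: fun_graph_eq_range)
    finally show ?thesis .
  qed
  ultimately show ?thesis
    unfolding EA_equivalent_def bij_def using assms(1-3) by blast
qed

theorem theoremB3:
  fixes m :: nat and F :: "'a::{field,finite} \<times> 'a \<Rightarrow> 'a \<times> 'a"
  assumes "even m"
    and "CARD('a) = 2 ^ m"
    and "carlet_function m F"
  shows "\<exists>G :: 'a \<times> 'a \<Rightarrow> 'a \<times> 'a. zhou_pott_function m G \<and> EA_equivalent F G"
proof -
  from assms(3) obtain k q b c d where carlet: "q = 2 ^ k \<and> 0 < k \<and> k < m \<and> gcd k m = 1 \<and>
      (\<forall>x :: 'a. x ^ (q + 1) + b * x ^ q + c * x + d \<noteq> 0) \<and>
      F = (\<lambda>(x, y). (x * y, qform q 1 b c d x y))"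
    unfolding carlet_function_def by (elim exE) (rule that)
  then have k: "q = 2 ^ k" "0 < k" "k < m" "gcd k m = 1"
    and F: "F = (\<lambda>(x, y). (x * y, qform q 1 b c d x y))"
    by - (elim conjE, assumption)+
  have P: "x ^ (q + 1) + b * x ^ q + c * x + d \<noteq> 0" for x :: 'a
    using carlet by (elim conjE) (erule spec)
  interpret coprime_frobenius "TYPE('a)" m k q
    by standard (use assms(1,2) k(1,4) in \<open>simp_all only: coprime_iff_gcd_eq_1\<close>)
  obtain p1 p2 p3 p4 \<alpha> \<beta> where det: "p1 * p4 + p2 * p3 \<noteq> 0"
    and Q: "\<And>x y. qform q 1 b c d x y = \<alpha> * (p1 * x + p2 * y) ^ (q + 1) + \<beta> * (p3 * x + p4 * y) ^ (q + 1)"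
    by (rule qform_diagonal_coordinates[OF P]) (rule that)
  define \<Delta> where "\<Delta> = p1 * p4 + p2 * p3"
  define M where "M = (\<lambda>(x, y). (p1 * x + p2 * y, p3 * x + p4 * y))"
  \<comment> \<open>The product of the two new coordinates is \<open>\<Delta> * x * y\<close> plus
    the squares collected in \<open>N\<close>. \<open>L\<close> swaps the two components of
    \<open>F\<close> and rescales them.\<close>
  define N where "N = (\<lambda>(x, y). (0 :: 'a, p1 * p3 * x ^ 2 + p2 * p4 * y ^ 2))"
  define L where "L = (\<lambda>(u, v). (v / \<alpha>, \<Delta> * u))"
  define G where "G = (\<lambda>(x, y). (qform q 1 0 0 (\<beta> / \<alpha>) x y, qform 1 0 0 1 0 x y))"
  have "inj M"
  proof (rule injI)
    fix v w assume "M v = M w"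
    moreover have "(p4 * fst (M v) + p2 * snd (M v), p3 * fst (M v) + p1 * snd (M v)) = (\<Delta> * fst v, \<Delta> * snd v)" for v
      by (simp add: M_def \<Delta>_def algebra_simps split: prod.split)
    ultimately have "(\<Delta> * fst v, \<Delta> * snd v) = (\<Delta> * fst w, \<Delta> * snd w)"
      by metis
    then show "v = w"
      using det by (simp add: \<Delta>_def prod_eq_iff)
  qed
  then have M: "bij M"
    by (simp add: bij_def finite_UNIV_inj_surj)
  \<comment> \<open>Anisotropy carries over to the diagonal form because \<open>M\<close> is onto
    and fixes 0.\<close>
  have nonzero: "\<alpha> * s ^ (q + 1) + \<beta> * t ^ (q + 1) \<noteq> 0" if "(s, t) \<noteq> 0" for s t
  proof -
    obtain x y where xy: "M (x, y) = (s, t)"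
      using M by (metis bij_pointE surj_pair)
    have "M (0, 0) = 0"
      by (simp add: M_def zero_prod_def)
    then have "(x, y) \<noteq> (0, 0)"
      using that xy by auto
    then have "qform q 1 b c d x y \<noteq> 0"
      using anisotropic[OF P] by blast
    then show ?thesis
      using xy by (simp add: Q M_def del: frob_add)
  qed
  have \<alpha>: "\<alpha> \<noteq> 0"
    using nonzero[of 1 0] by (simp add: zero_prod_def)
  have "inj L"
    using \<alpha> det by (auto simp: inj_def L_def \<Delta>_def)
  then have L: "bij L"
    by (simp add: bij_def finite_UNIV_inj_surj)
  have "EA_equivalent F G"
  proof (rule EA_equivalentI[where N = N, OF _ _ _ M L])
    show "F2_linear M" "F2_linear L"
      by (auto intro!: F2_linearI simp: M_def L_def algebra_simps add_divide_distrib)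
    show "F2_linear N"
      by (auto intro!: F2_linearI simp: N_def algebra_simps power2_sum)
    show "G (M z) = N z + L (F z)" for z
    proof -
      obtain x y where z: "z = (x, y)"
        by fastforce
      have "qform q 1 0 0 (\<beta> / \<alpha>) s t = (\<alpha> * s ^ (q + 1) + \<beta> * t ^ (q + 1)) / \<alpha>" for s t
        using \<alpha> by (simp add: qform_def add_divide_distrib)
      then show ?thesis
        unfolding z by (simp only: G_def M_def N_def L_def F Q prod.case add_Pair)
          (simp add: qform_def \<Delta>_def algebra_simps power2_eq_square)
    qed
  qed
  moreover have "zhou_pott_function m G"
  proof -
    \<comment> \<open>For \<open>r = 1\<close> the power with exponent \<open>1 - r\<close> is 1, so
      this is the whole Zhou-Pott condition. A violation would make \<open>(s, 1)\<close>
      isotropic.\<close>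
    have "\<beta> / \<alpha> \<noteq> s ^ (q + 1)" for s
    proof
      assume "\<beta> / \<alpha> = s ^ (q + 1)"
      then have "\<alpha> * s ^ (q + 1) + \<beta> * 1 ^ (q + 1) = 0"
        using \<alpha> by (simp add: add_eq_0_iff_eq field_simps)
      then show False
        using nonzero[of s 1] by (simp add: zero_prod_def)
    qed
    then show ?thesis
      unfolding zhou_pott_function_def
      using assms(1) k G_def by (intro conjI exI[of _ k] exI[of _ q] exI[of _ 0] exI[of _ 1] exI[of _ "\<beta> / \<alpha>"]) auto
  qed
  ultimately show ?thesis
    by blast
qed

end
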